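(* Let $k \ge r \ge 1$ be integers and let $\mathcal{F}$ be a family of $r$-graphs, each having at least one edge. If every member of $\mathcal{F}$ is a pair-covering $r$-graph, then the limit $$\lim_{n\to\infty} L(n,k,r,\mathcal{F})\, n^{-r}$$ exists (as a finite real number).
   Context: For a positive integer $k$, a $k$-graph with (finite) vertex set $V$ is a system (set) of $k$-element subsets of $V$, called edges. The complement of an $r$-graph on $V$ is the $r$-graph on $V$ whose edges are exactly the $r$-element subsets of $V$ that are not edges of the original. For $r \le k$, the $r$-shadow of a $k$-graph $H$ is the $r$-graph with the same vertex set whose edges are the $r$-element subsets of $V$ contained in edges of $H$. An $r$-graph is $\mathcal{F}$-free if it does not contain a (not necessarily induced) subgraph isomorphic to a member of $\mathcal{F}$. An $r$-graph is pair-covering if any pair of (distinct) vertices of it is contained in an edge. $L(n,k,r,\mathcal{F})$ denotes the minimum number of edges in an $n$-vertex $k$-graph such that the complement of its $r$-shadow is $\mathcal{F}$-free. This is considered for $n \ge k$, where the minimum is over a nonempty set since the complete $k$-graph qualifies. *)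

theory Defs
  imports Complex_Main
begin

text \<open>A hypergraph is a pair of a vertex set and a set of edges.\<close>

type_synonym 'a hgraph = "'a set \<times> 'a set set"

abbreviation verts :: "'a hgraph \<Rightarrow> 'a set" where
  "verts G \<equiv> fst G"

abbreviation edges :: "'a hgraph \<Rightarrow> 'a set set" where
  "edges G \<equiv> snd G"

definition uniform :: "nat \<Rightarrow> 'a hgraph \<Rightarrow> bool" where
  "uniform k G \<longleftrightarrow> finite (verts G) \<and> (\<forall>e\<in>edges G. e \<subseteq> verts G \<and> card e = k)"

definition complement :: "nat \<Rightarrow> 'a hgraph \<Rightarrow> 'a hgraph" where
  "complement r G = (verts G, {e. e \<subseteq> verts G \<and> card e = r \<and> e \<notin> edges G})"

definition shadow :: "nat \<Rightarrow> 'a hgraph \<Rightarrow> 'a hgraph" where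
  "shadow r H = (verts H, {e. e \<subseteq> verts H \<and> card e = r \<and> (\<exists>h\<in>edges H. e \<subseteq> h)})"

definition subgraph :: "nat \<Rightarrow> 'a hgraph \<Rightarrow> 'a hgraph \<Rightarrow> bool" where
  "subgraph r G' G \<longleftrightarrow> uniform r G' \<and> verts G' \<subseteq> verts G \<and> edges G' \<subseteq> edges G"

definition isomorphic :: "'a hgraph \<Rightarrow> 'b hgraph \<Rightarrow> bool" where
  "isomorphic G H \<longleftrightarrow>
     (\<exists>f. bij_betw f (verts G) (verts H) \<and> edges H = (\<lambda>e. f ` e) ` edges G)"

definition free_of :: "nat \<Rightarrow> 'b hgraph set \<Rightarrow> 'a hgraph \<Rightarrow> bool" where
  "free_of r \<F> G \<longleftrightarrow> \<not> (\<exists>F\<in>\<F>. \<exists>G'. subgraph r G' G \<and> isomorphic F G')"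

definition pair_covering :: "'a hgraph \<Rightarrow> bool" where
  "pair_covering G \<longleftrightarrow>
     (\<forall>x\<in>verts G. \<forall>y\<in>verts G. x \<noteq> y \<longrightarrow> (\<exists>e\<in>edges G. x \<in> e \<and> y \<in> e))"

text \<open>Every finite graph is isomorphic to one on natural numbers, so the minimum may be taken
  over graphs of type \<open>nat hgraph\<close>. For \<open>n \<ge> k\<close> the minimum is over a nonempty set if every
  member of the family has an edge; for \<open>n < k\<close> the value may be unspecified.\<close>

definition L :: "nat \<Rightarrow> nat \<Rightarrow> nat \<Rightarrow> 'a hgraph set \<Rightarrow> nat" where
  "L n k r \<F> = (LEAST m. \<exists>H :: nat hgraph. uniform k H \<and> card (verts H) = n \<and>
     free_of r \<F> (complement r (shadow r H)) \<and> card (edges H) = m)"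

lemma L_nonempty:
  fixes \<F> :: "'a hgraph set"
  assumes rk: "r \<le> k" and nk: "k \<le> n" and ne: "\<And>F. F \<in> \<F> \<Longrightarrow> edges F \<noteq> {}"
  shows "\<exists>H :: nat hgraph. uniform k H \<and> card (verts H) = n \<and>
     free_of r \<F> (complement r (shadow r H))"
proof -
  let ?H = "({..<n}, {e. e \<subseteq> {..<n} \<and> card e = k})"
  have "\<exists>h. e \<subseteq> h \<and> h \<subseteq> {..<n} \<and> card h = k" if "e \<subseteq> {..<n}" "card e = r" for e
    using exists_subset_between[of e k "{..<n}"] that rk nk by auto
  hence "edges (complement r (shadow r ?H)) = {}"
    by (auto simp: complement_def shadow_def)
  hence "free_of r \<F> (complement r (shadow r ?H))"
    using ne by (auto simp: free_of_def subgraph_def isomorphic_def)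
  moreover have "uniform k ?H" by (auto simp: uniform_def)
  ultimately show ?thesis by (intro exI[of _ ?H]) auto
qed

end

theory Submission
  imports Defs "HOL-Library.FuncSet" "HOL-Computational_Algebra.Polynomial" "HOL-Number_Theory.Cong"
begin

text \<open>Put \<open>f n = L(n, k, r, \<F>) / n ^ r\<close>. Blow up an optimal \<open>k\<close>-graph on \<open>n\<close> vertices by
  replacing each vertex with \<open>m\<close> copies, where \<open>m\<close> is prime to \<open>n!\<close>. The \<open>m ^ r\<close> polynomials of
  degree less than \<open>r\<close> over the integers modulo \<open>m\<close> form a Reed--Solomon code, whose graphs cover
  all \<open>r\<close>-sets that project injectively onto a shadow edge, at a cost of \<open>m ^ r\<close> edges per edge of
  the original graph. The \<open>r\<close>-sets that meet some class twice are covered one by one. The uncovered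
  \<open>r\<close>-sets project to uncovered ones, and a pair-covering graph meets each class at most once, so
  the uncovered graph stays \<open>\<F>\<close>-free. Choosing \<open>m \<equiv> 1\<close> modulo \<open>n!\<close> just above \<open>N / n\<close> gives
  \<open>f N \<le> f n + 1 / n + o(1)\<close> for fixed \<open>n\<close> and \<open>N \<rightarrow> \<infinity>\<close>, whence convergence.\<close>

section \<open>Interpolation modulo m and Reed-Solomon codes\<close>

text \<open>Newton interpolation works although \<open>m\<close> need not be prime: the only numbers
  to be inverted are products of differences of distinct nodes below \<open>n\<close>, and each such
  difference divides the factorial of \<open>n\<close>, hence is a unit modulo
  \<open>m\<close>.\<close>

lemma int_poly_interpolation_mod:
  fixes y :: "nat \<Rightarrow> int" and m :: int
  assumes "S \<subseteq> {..<n}" and m: "coprime m (fact n)"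
  shows "\<exists>p :: int poly. (\<forall>i\<ge>card S. coeff p i = 0) \<and>
    (\<forall>x\<in>S. [poly p (int x) = y x] (mod m))"
proof -
  have "finite S"
    using assms(1) finite_subset by blast
  then show ?thesis using assms(1)
  proof (induction S rule: finite_induct)
    case empty
    show ?case by (intro exI[of _ 0]) simp
  next
    case (insert z S)
    then obtain p :: "int poly" where
      p0: "\<And>i. i \<ge> card S \<Longrightarrow> coeff p i = 0" and
      p: "\<And>x. x \<in> S \<Longrightarrow> [poly p (int x) = y x] (mod m)" by auto
    define q :: "int poly" where "q = (\<Prod>x\<in>S. [:- int x, 1:])"
    have polyq: "poly q t = (\<Prod>x\<in>S. t - int x)" for t
      by (simp add: q_def poly_prod)
    have degq: "degree q \<le> card S"
      using degree_prod_sum_le[OF insert.hyps(1), of "\<lambda>x. [:- int x, 1:]"] by (simp add: q_def)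
    have "coprime (int z - int x) m" if "x \<in> S" for x
    proof -
      define d where "d = nat \<bar>int z - int x\<bar>"
      have "x \<noteq> z" "x < n" "z < n"
        using that insert.hyps insert.prems by auto
      then have "1 \<le> d" "d \<le> n"
        unfolding d_def by linarith+
      then have "d dvd fact n" by (rule dvd_fact)
      then have "int d dvd fact n"
        using int_dvd_int_iff[of d "fact n"] by simp
      then have "coprime (int d) m"
        using m by (metis coprime_commute coprime_divisors dvd_refl)
      then show ?thesis by (simp add: d_def)
    qed
    then have "coprime (poly q (int z)) m"
      unfolding polyq by (rule prod_coprime_left)
    then obtain c where c: "[poly q (int z) * c = 1] (mod m)"
      using cong_solve_coprime_int by blast
    \<comment> \<open>The correction vanishes at the old nodes. At \<open>z\<close> the inverse
      \<open>c\<close> makes it congruent to the missing difference.\<close>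
    define p' where "p' = p + smult (c * (y z - poly p (int z))) q"
    have "coeff p' i = 0" if "i \<ge> card (insert z S)" for i
      using that insert.hyps p0[of i] degq by (simp add: p'_def coeff_eq_0)
    moreover have "[poly p' (int x) = y x] (mod m)" if "x \<in> insert z S" for x
    proof (cases "x = z")
      case True
      have "[poly p (int z) + (poly q (int z) * c) * (y z - poly p (int z)) =
          poly p (int z) + 1 * (y z - poly p (int z))] (mod m)"
        by (intro cong_add cong_mult c cong_refl)
      then show ?thesis by (simp add: True p'_def mult_ac)
    next
      case False
      then have "x \<in> S" using that by auto
      moreover from this have "poly q (int x) = 0"
        unfolding polyq using insert.hyps by (simp add: prod_zero_iff)
      ultimately show ?thesis using p by (simp add: p'_def)
    qed
    ultimately show ?case by blast
  qed
qed

text \<open>Entry at position \<open>x\<close> of the Reed-Solomon codeword with message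
  \<open>a\<close>. In the blow-up it names the copy to take from class \<open>x\<close>.\<close>

definition codeword :: "nat \<Rightarrow> nat \<Rightarrow> (nat \<Rightarrow> nat) \<Rightarrow> nat \<Rightarrow> nat" where
  "codeword m r a x = (\<Sum>i<r. a i * x ^ i) mod m"

lemma codeword_interpolation:
  assumes "S \<subseteq> {..<n}" "card S = r" "coprime m (fact n)" "m > 0" "\<And>x. x \<in> S \<Longrightarrow> y x < m"
  shows "\<exists>a \<in> {..<r} \<rightarrow>\<^sub>E {..<m}. \<forall>x\<in>S. codeword m r a x = y x"
proof -
  have "coprime (int m) (fact n)"
    using assms(3) coprime_int_iff[of m "fact n"] by simp
  from int_poly_interpolation_mod[OF assms(1) this, of "\<lambda>x. int (y x)"] obtain p where
    p0: "\<And>i. i \<ge> r \<Longrightarrow> coeff p i = 0" and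
    p: "\<And>x. x \<in> S \<Longrightarrow> [poly p (int x) = int (y x)] (mod int m)"
    using assms(2) by auto
  \<comment> \<open>Reducing to residues and restricting to \<open>{..<r}\<close> puts
    \<open>a\<close> in a set of exactly \<open>m ^ r\<close> functions, the source of the factor
    \<open>m ^ r\<close> in the cost.\<close>
  define a where "a = (\<lambda>i\<in>{..<r}. nat (coeff p i mod int m))"
  have "a \<in> {..<r} \<rightarrow>\<^sub>E {..<m}"
    using \<open>m > 0\<close> by (auto simp: a_def nat_less_iff)
  moreover have "codeword m r a x = y x" if "x \<in> S" for x
  proof -
    have poly_eq: "poly p (int x) = (\<Sum>i<r. coeff p i * int x ^ i)"
    proof -
      have "(\<Sum>i\<le>degree p. coeff p i * int x ^ i) = (\<Sum>i<r. coeff p i * int x ^ i)"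
        by (rule sum.mono_neutral_cong)
          (auto simp: coeff_eq_0 p0 not_less not_le)
      then show ?thesis by (simp add: poly_altdef)
    qed
    have "[int (\<Sum>i<r. a i * x ^ i) = (\<Sum>i<r. coeff p i * int x ^ i)] (mod int m)"
      unfolding of_nat_sum of_nat_mult of_nat_power
      using \<open>m > 0\<close> by (intro cong_sum cong_mult cong_refl) (auto simp: a_def)
    then have "[int (\<Sum>i<r. a i * x ^ i) = int (y x)] (mod int m)"
      by (rule cong_trans) (use p[OF that] poly_eq in simp)
    then have "[(\<Sum>i<r. a i * x ^ i) = y x] (mod m)"
      by (simp only: cong_int_iff)
    then show ?thesis
      using assms(5)[OF that] by (simp add: codeword_def cong_def)
  qed
  ultimately show ?thesis by blast
qed

section \<open>Freeness, covers and projections\<close>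

lemma free_of_antimono:
  fixes V :: "'b set"
  assumes "free_of r \<F> (V, E)" "E' \<subseteq> E"
  shows "free_of r \<F> (V, E')"
proof -
  have "subgraph r G' (V, E)" if "subgraph r G' (V, E')" for G' :: "'b hgraph"
    using that assms(2) by (auto simp: subgraph_def)
  then show ?thesis
    using assms(1) unfolding free_of_def by blast
qed

lemma finite_edges_uniform: "uniform k H \<Longrightarrow> finite (edges H)"
  unfolding uniform_def by (rule finite_subset[of _ "Pow (verts H)"]) auto

text \<open>The covering sets may be smaller than \<open>k\<close> here, as they can be enlarged without cost.\<close>

lemma L_le_card_cover:
  fixes V :: "nat set"
  assumes V: "finite V" "card V = N" "k \<le> N" and K: "finite K" "\<And>h. h \<in> K \<Longrightarrow> h \<subseteq> V \<and> card h \<le> k"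
    and free: "free_of r \<F> (V, {e. e \<subseteq> V \<and> card e = r \<and> \<not> (\<exists>h\<in>K. e \<subseteq> h)})"
  shows "L N k r \<F> \<le> card K"
proof -
  have "\<forall>h\<in>K. \<exists>g. h \<subseteq> g \<and> g \<subseteq> V \<and> card g = k"
  proof
    fix h assume "h \<in> K"
    then show "\<exists>g. h \<subseteq> g \<and> g \<subseteq> V \<and> card g = k"
      using exists_subset_between[of h k V] K(2)[of h] V by blast
  qed
  then obtain g where g: "\<And>h. h \<in> K \<Longrightarrow> h \<subseteq> g h \<and> g h \<subseteq> V \<and> card (g h) = k"
    by metis
  let ?H = "(V, g ` K)"
  have "uniform k ?H" using g V by (auto simp: uniform_def)
  moreover have "free_of r \<F> (complement r (shadow r ?H))"
  proof -
    have "\<not> e \<subseteq> h" if "\<not> (\<exists>h\<in>g ` K. e \<subseteq> h)" "h \<in> K" for e h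
      using that g[OF that(2)] by auto
    then show ?thesis
      unfolding complement_def shadow_def fst_conv snd_conv
      by (intro free_of_antimono[OF free]) blast
  qed
  ultimately have "L N k r \<F> \<le> card (g ` K)"
    unfolding L_def using V by (intro Least_le exI[of _ ?H]) auto
  then show ?thesis using card_image_le[OF K(1), of g] by simp
qed

text \<open>Any two vertices of a copy of a pair-covering graph share an edge, and \<open>c\<close>
  is injective on edges. So \<open>c\<close> is injective on the whole copy and maps it to a copy in
  \<open>(U, E)\<close>.\<close>

lemma free_of_lift:
  assumes free: "free_of r \<F> (U, E)"
    and pc: "\<And>F. F \<in> \<F> \<Longrightarrow> pair_covering F"
    and c: "c ` V \<subseteq> U" "finite U"
    and edge: "\<And>e. e \<in> E' \<Longrightarrow> e \<subseteq> V \<Longrightarrow> card e = r \<Longrightarrow> inj_on c e \<and> c ` e \<in> E"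
  shows "free_of r \<F> (V, E')"
  unfolding free_of_def
proof (intro notI, elim bexE exE conjE)
  fix F G'
  assume F: "F \<in> \<F>" and G': "subgraph r G' (V, E')" and iso: "isomorphic F G'"
  from iso obtain f where f: "bij_betw f (verts F) (verts G')"
    and fe: "edges G' = (\<lambda>e. f ` e) ` edges F"
    unfolding isomorphic_def by blast
  have e': "e \<in> E' \<and> e \<subseteq> V \<and> card e = r \<and> e \<subseteq> verts G'" if "e \<in> edges G'" for e
    using that G' by (auto simp: subgraph_def uniform_def)
  have "inj_on c (verts G')"
  proof (rule inj_onI, rule ccontr)
    fix x y assume xy: "x \<in> verts G'" "y \<in> verts G'" "c x = c y" "x \<noteq> y"
    then obtain u v where uv: "u \<in> verts F" "v \<in> verts F" "x = f u" "y = f v"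
      using f unfolding bij_betw_def by blast
    then obtain e where "e \<in> edges F" "u \<in> e" "v \<in> e"
      using pc[OF F] xy unfolding pair_covering_def by metis
    then have "f ` e \<in> edges G'" "x \<in> f ` e" "y \<in> f ` e"
      using fe uv by auto
    then show False using e' edge xy by (meson inj_onD)
  qed
  then have bij: "bij_betw (c \<circ> f) (verts F) (c ` verts G')"
    using f by (meson bij_betw_trans inj_on_imp_bij_betw)
  let ?G = "(c ` verts G', (\<lambda>e. c ` e) ` edges G')"
  have "isomorphic F ?G"
    unfolding isomorphic_def using bij fe by (intro exI[of _ "c \<circ> f"]) (auto simp: image_image image_comp)
  moreover have "subgraph r ?G (U, E)"
  proof -
    have "verts G' \<subseteq> V" using G' by (simp add: subgraph_def)
    then have "c ` verts G' \<subseteq> U" using c by auto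
    moreover have "c ` e \<in> E \<and> c ` e \<subseteq> c ` verts G' \<and> card (c ` e) = r" if "e \<in> edges G'" for e
      using e'[OF that] edge[of e] by (auto simp: card_image)
    ultimately show ?thesis
      using c by (auto simp: subgraph_def uniform_def intro: finite_subset)
  qed
  ultimately show False using free F unfolding free_of_def by blast
qed

section \<open>The blow-up inequality\<close>

text \<open>Such a set contains distinct \<open>v\<close> and \<open>w\<close> in one class. There
  are \<open>N\<close> choices for \<open>v\<close>, then at most \<open>m\<close> for
  \<open>w\<close>, fixed by its quotient, and at most \<open>N ^ (r - 2)\<close> for the
  rest.\<close>

lemma card_not_inj_mod_le:
  assumes "N \<le> n * m" "n > 0" "r \<ge> 1"
  shows "card {e. e \<subseteq> {..<N} \<and> card e = r \<and> \<not> inj_on (\<lambda>v. v mod n) e} \<le> m * N ^ (r - 1)"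
    (is "card ?B \<le> _")
\<comment> \<open>For \<open>r = 1\<close> the truncated \<open>r - 2\<close> is 0 and the count
  would only give \<open>N * m\<close>, so singletons are treated apart.\<close>
proof (cases "r = 1")
  case True
  then have "?B = {}" by (auto simp: card_1_singleton_iff)
  then show ?thesis by (simp only: card.empty)
next
  case False
  define T where "T = {e. e \<subseteq> {..<N} \<and> card e = r - 2}"
  have "?B \<subseteq> (\<lambda>(v, q, e). {v, q * n + v mod n} \<union> e) ` ({..<N} \<times> {..<m} \<times> T)"
  proof
    fix e assume "e \<in> ?B"
    then obtain v w where e: "e \<subseteq> {..<N}" "card e = r" "v \<in> e" "w \<in> e"
      and vw: "v \<noteq> w" "v mod n = w mod n"
      by (auto simp: inj_on_def)
    have "w div n < m"
    proof -
      have "w < m * n" using e assms(1) by (auto simp: mult.commute)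
      then show ?thesis by (rule less_mult_imp_div_less)
    qed
    moreover have "(w div n) * n + v mod n = w" using vw by simp
    moreover have "e - {v, w} \<in> T"
      using e vw finite_subset[OF e(1)] by (auto simp: T_def card_Diff_subset)
    moreover have "{v, w} \<union> (e - {v, w}) = e" using e by auto
    ultimately show "e \<in> (\<lambda>(v, q, e). {v, q * n + v mod n} \<union> e) ` ({..<N} \<times> {..<m} \<times> T)"
      using e by (intro image_eqI[of _ _ "(v, w div n, e - {v, w})"]) auto
  qed
  moreover have finT: "finite T" by (simp add: T_def)
  ultimately have "card ?B \<le> card ({..<N} \<times> {..<m} \<times> T)"
    by (intro surj_card_le) auto
  also have "\<dots> = N * (m * card T)" by (simp add: card_cartesian_product)
  also have "card T \<le> N ^ (r - 2)"
  proof (cases "r - 2 \<le> N")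
    case True
    then show ?thesis by (simp add: T_def n_subsets binomial_le_pow)
  qed (simp add: T_def n_subsets binomial_eq_0)
  also have "N * (m * N ^ (r - 2)) = m * N ^ (r - 1)"
  proof -
    have "r - 1 = Suc (r - 2)" using False assms by simp
    then show ?thesis by simp
  qed
  finally show ?thesis by simp
qed

text \<open>The first term pays for one covering set per codeword and edge of an optimal graph on
  \<open>n\<close> vertices, the second for the \<open>r\<close>-sets that meet some class
  twice.\<close>

lemma L_blowup:
  fixes \<F> :: "'a hgraph set"
  assumes r: "1 \<le> r" "r \<le> k" and n: "k \<le> n"
    and ne: "\<And>F. F \<in> \<F> \<Longrightarrow> edges F \<noteq> {}" and pc: "\<And>F. F \<in> \<F> \<Longrightarrow> pair_covering F"
    and m: "coprime m (fact n)" and N: "k \<le> N" "N \<le> n * m"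
  shows "L N k r \<F> \<le> m ^ r * L n k r \<F> + m * N ^ (r - 1)"
proof -
  have pos: "n > 0" "m > 0" using r n N by (auto intro: Nat.gr0I)
  have "\<exists>t. \<exists>H :: nat hgraph. uniform k H \<and> card (verts H) = n \<and>
     free_of r \<F> (complement r (shadow r H)) \<and> card (edges H) = t"
    using L_nonempty[OF r(2) n ne] by blast
  from LeastI_ex[OF this] obtain H :: "nat hgraph" where H: "uniform k H" "card (verts H) = n"
    "free_of r \<F> (complement r (shadow r H))" "card (edges H) = L n k r \<F>"
    unfolding L_def by blast
  have finU: "finite (verts H)" using H(1) by (simp add: uniform_def)
  obtain b where b: "bij_betw b {..<n} (verts H)"
    using ex_bij_betw_nat_finite[OF finU] H(2) by (auto simp: lessThan_atLeast0)
  \<comment> \<open>The number \<open>v\<close> stands for copy \<open>v div n\<close> of the vertex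
    \<open>c v\<close>.\<close>
  define c where "c v = b (v mod n)" for v
  define V where "V = {..<N}"
  have cU: "c ` V \<subseteq> verts H"
    using b pos by (auto simp: c_def bij_betw_def)
  have c_eq: "c v = c w \<longleftrightarrow> v mod n = w mod n" for v w
    using b pos by (auto simp: c_def bij_betw_def inj_on_def)
  have div: "v div n < m" if "v \<in> V" for v
    using that N pos by (simp add: V_def div_less_iff_less_mult mult.commute)
  let ?P = "{..<r} \<rightarrow>\<^sub>E {..<m}"
  \<comment> \<open>From each class over \<open>h\<close>, take the copy named by the codeword of
    \<open>a\<close>, if it lies below \<open>N\<close>. Such a set has at most one vertex over each
    vertex of \<open>h\<close>.\<close>
  define S where "S = (\<lambda>(a, h). {v \<in> V. v div n = codeword m r a (v mod n) \<and> c v \<in> h})"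
  define K1 where "K1 = S ` (?P \<times> edges H)"
  define K2 where "K2 = {e. e \<subseteq> {..<N} \<and> card e = r \<and> \<not> inj_on (\<lambda>v. v mod n) e}"
  have finE: "finite (edges H)" by (rule finite_edges_uniform[OF H(1)])
  have finP: "finite ?P" by (intro finite_PiE) auto
  have K: "finite K1" "finite K2"
    using finP finE by (auto simp: K1_def K2_def)
  have "card K1 \<le> card (?P \<times> edges H)"
    unfolding K1_def using finP finE by (intro card_image_le) auto
  also have "\<dots> = m ^ r * L n k r \<F>"
    by (simp add: card_cartesian_product card_PiE H(4))
  finally have K1: "card K1 \<le> m ^ r * L n k r \<F>" .
  have K2: "card K2 \<le> m * N ^ (r - 1)"
    unfolding K2_def by (rule card_not_inj_mod_le) (use N pos r in auto)
  have S_le: "card (S (a, h)) \<le> k" if "h \<in> edges H" for a h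
  proof -
    have h: "finite h" "card h = k"
      using that H(1) by (auto simp: uniform_def intro: finite_subset)
    have "inj_on c (S (a, h))"
    proof (rule inj_onI)
      fix v w assume "v \<in> S (a, h)" "w \<in> S (a, h)" "c v = c w"
      then have "v mod n = w mod n" "v div n = w div n"
        by (auto simp: S_def c_eq)
      then show "v = w" by (metis div_mult_mod_eq)
    qed
    moreover have "c ` S (a, h) \<subseteq> h" by (auto simp: S_def)
    ultimately show ?thesis using h card_inj_on_le by metis
  qed
  have "free_of r \<F> (V, {e. e \<subseteq> V \<and> card e = r \<and> \<not> (\<exists>h\<in>K1 \<union> K2. e \<subseteq> h)})"
  proof (rule free_of_lift[OF _ pc cU finU])
    show "free_of r \<F> (verts H, edges (complement r (shadow r H)))"
      using H(3) by (simp add: complement_def shadow_def)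
    fix e assume e: "e \<in> {e. e \<subseteq> V \<and> card e = r \<and> \<not> (\<exists>h\<in>K1 \<union> K2. e \<subseteq> h)}"
    then have eV: "e \<subseteq> V" "card e = r" and nK: "\<not> (\<exists>h\<in>K1. e \<subseteq> h)" "e \<notin> K2"
      by auto
    have inj: "inj_on (\<lambda>v. v mod n) e"
      using nK(2) eV by (auto simp: K2_def V_def)
    then have injc: "inj_on c e" by (auto simp: inj_on_def c_eq)
    have "\<not> c ` e \<subseteq> h" if h: "h \<in> edges H" for h
    proof
      assume sub: "c ` e \<subseteq> h"
      \<comment> \<open>Since \<open>e\<close> meets each class at most once, the copy number is a
        function of the class on the \<open>r\<close> classes met by \<open>e\<close>, and a
        codeword can interpolate it.\<close>
      define y where "y x = the_inv_into e (\<lambda>v. v mod n) x div n" for x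
      have y: "y (v mod n) = v div n" if "v \<in> e" for v
        using the_inv_into_f_f[OF inj that] by (simp add: y_def)
      have "\<exists>a \<in> ?P. \<forall>x\<in>(\<lambda>v. v mod n) ` e. codeword m r a x = y x"
        using pos m eV div by (intro codeword_interpolation) (auto simp: card_image[OF inj] y)
      then obtain a where a: "a \<in> ?P" "\<And>v. v \<in> e \<Longrightarrow> codeword m r a (v mod n) = v div n"
        using y by auto
      then have "e \<subseteq> S (a, h)" using eV sub by (auto simp: S_def)
      moreover have "S (a, h) \<in> K1" using a h by (auto simp: K1_def)
      ultimately show False using nK by blast
    qed
    moreover have "c ` e \<subseteq> verts H" using eV cU by auto
    moreover have "card (c ` e) = r" using injc eV by (simp add: card_image)
    ultimately show "inj_on c e \<and> c ` e \<in> edges (complement r (shadow r H))"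
      using injc by (auto simp: complement_def shadow_def)
  qed
  then have "L N k r \<F> \<le> card (K1 \<union> K2)"
    using K S_le r N
    by (intro L_le_card_cover[of V]) (auto simp: V_def K1_def K2_def, auto simp: S_def V_def)
  also have "\<dots> \<le> card K1 + card K2" by (rule card_Un_le)
  finally show ?thesis using K1 K2 by linarith
qed

section \<open>Existence of the limit\<close>

text \<open>The limit is the infimum \<open>l\<close> of \<open>g n = f n + 1 / n\<close> over
  \<open>n \<ge> n0\<close>. An almost optimal \<open>n\<close> bounds \<open>f N\<close> from above
  for large \<open>N\<close>, while \<open>f N = g N - 1 / N\<close> is at least
  \<open>l - 1 / N\<close>.\<close>

lemma convergent_of_eventually_le:
  fixes f :: "nat \<Rightarrow> real"
  assumes nonneg: "\<And>n. 0 \<le> f n"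
    and ev: "\<And>n \<epsilon>. n0 \<le> n \<Longrightarrow> \<epsilon> > 0 \<Longrightarrow> eventually (\<lambda>N. f N \<le> f n + 1 / real n + \<epsilon>) sequentially"
  shows "convergent f"
proof -
  define g where "g n = f n + 1 / real n" for n
  define l where "l = (INF n\<in>{n0..}. g n)"
  have bdd: "bdd_below (g ` {n0..})"
    by (rule bdd_belowI[of _ 0]) (auto simp: g_def nonneg)
  have "f \<longlonglongrightarrow> l"
  proof (rule tendstoI)
    fix \<epsilon> :: real assume \<epsilon>: "\<epsilon> > 0"
    then have "\<exists>x\<in>g ` {n0..}. x < l + \<epsilon> / 2"
      unfolding l_def using bdd by (subst cInf_less_iff[symmetric]) auto
    then obtain n where n: "n0 \<le> n" "g n < l + \<epsilon> / 2" by auto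
    have "eventually (\<lambda>N. f N \<le> g n + \<epsilon> / 2) sequentially"
      using ev[OF n(1), of "\<epsilon> / 2"] \<epsilon> by (simp add: g_def)
    moreover have "eventually (\<lambda>N. 1 / real N < \<epsilon>) sequentially"
      using lim_1_over_n[where 'a = real] \<epsilon> by (auto dest: order_tendstoD)
    moreover have "eventually (\<lambda>N. N \<ge> n0) sequentially" by (rule eventually_ge_at_top)
    ultimately show "eventually (\<lambda>N. dist (f N) l < \<epsilon>) sequentially"
    proof eventually_elim
      case (elim N)
      have "l \<le> g N" unfolding l_def using elim bdd by (intro cINF_lower) auto
      then show ?case using elim n by (auto simp: dist_real_def g_def abs_less_iff)
    qed
  qed
  then show ?thesis by (rule convergentI)
qed

lemma ex_coprime_blowup_factor:
  assumes "n > 0"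
  shows "\<exists>m. coprime m (fact n) \<and> N \<le> n * m \<and> real m \<le> real N / real n + (1 + fact n)"
proof -
  define d :: nat where "d = fact n"
  \<comment> \<open>One more than the first multiple of \<open>d\<close> above
    \<open>N div n\<close>: coprime to \<open>d\<close>, and only a bounded amount above
    \<open>N / n\<close> when \<open>n\<close> is fixed.\<close>
  define m where "m = d * (N div n div d + 1) + 1"
  have d: "d > 0" by (simp add: d_def)
  have "coprime (d * (N div n div d + 1)) m"
    unfolding m_def Suc_eq_plus1[symmetric] by (rule coprime_Suc_right_nat)
  then have "coprime d m" by (simp only: coprime_mult_left_iff)
  then have cop: "coprime m d" by (simp only: coprime_commute)
  have m: "N div n < m" "m \<le> N div n + d + 1"
    using mult_div_mod_eq[of d "N div n"] mod_less_divisor[OF d, of "N div n"]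
    unfolding m_def distrib_left mult_1_right by linarith+
  have "N < n * (N div n + 1)"
    using assms by (simp add: dividend_less_times_div)
  also have "\<dots> \<le> n * m" using m by (intro mult_left_mono) auto
  finally have "N \<le> n * m" by simp
  moreover note cop
  moreover have "real m \<le> real N / real n + (1 + fact n)"
  proof -
    have "real m \<le> real (N div n) + (real d + 1)" using m(2) by linarith
    also have "real (N div n) \<le> real N / real n" by (rule of_nat_div_le_of_nat)
    finally show ?thesis by (simp add: d_def)
  qed
  ultimately show ?thesis unfolding d_def by blast
qed

theorem theorem1:
  fixes k r :: nat and \<F> :: "'a hgraph set"
  assumes "1 \<le> r" and "r \<le> k"
    and "\<And>F. F \<in> \<F> \<Longrightarrow> uniform r F"
    and "\<And>F. F \<in> \<F> \<Longrightarrow> edges F \<noteq> {}"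
    and "\<And>F. F \<in> \<F> \<Longrightarrow> pair_covering F"
  shows "convergent (\<lambda>n. real (L n k r \<F>) / real n ^ r)"
proof (rule convergent_of_eventually_le[where ?n0.0 = k])
  fix n and \<epsilon> :: real
  assume n: "k \<le> n" and \<epsilon>: "\<epsilon> > 0"
  define f where "f n = real (L n k r \<F>) / real n ^ r" for n
  define C :: real where "C = 1 + fact n"
  \<comment> \<open>An upper bound for \<open>m / N\<close> that does not depend on the choice of
    \<open>m\<close>. As it tends to \<open>1 / n\<close>, the main term of the blow-up bound tends
    to \<open>f n\<close> and the other term to \<open>1 / n\<close>.\<close>
  define u where "u N = 1 / real n + C * (1 / real N)" for N
  have n0: "n > 0" using assms n by linarith
  have f0: "f n \<ge> 0" by (simp add: f_def)
  have u: "u \<longlonglongrightarrow> 1 / real n"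
  proof -
    have "u \<longlonglongrightarrow> 1 / real n + C * 0"
      unfolding u_def by (intro tendsto_intros lim_1_over_n)
    then show ?thesis by simp
  qed
  have "(\<lambda>N. (n * u N) ^ r * f n + u N) \<longlonglongrightarrow> (n * (1 / real n)) ^ r * f n + 1 / real n"
    by (intro tendsto_intros u)
  then have "eventually (\<lambda>N. (n * u N) ^ r * f n + u N < f n + 1 / real n + \<epsilon>) sequentially"
    using n0 \<epsilon> by (intro order_tendstoD) auto
  moreover have "eventually (\<lambda>N. N \<ge> k) sequentially" by (rule eventually_ge_at_top)
  ultimately show "eventually (\<lambda>N. real (L N k r \<F>) / real N ^ r \<le>
      real (L n k r \<F>) / real n ^ r + 1 / real n + \<epsilon>) sequentially"
  proof eventually_elim
    case (elim N)
    have N0: "N > 0" using assms elim by linarith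
    obtain m where m: "coprime m (fact n)" "N \<le> n * m" "real m \<le> real N / real n + C"
      using ex_coprime_blowup_factor[OF n0] unfolding C_def by blast
    have mu: "real m / real N \<le> u N"
      using m(3) N0 by (simp add: u_def field_simps)
    have "real (L N k r \<F>) \<le> real (m ^ r * L n k r \<F> + m * N ^ (r - 1))"
      using L_blowup[OF assms(1,2) n assms(4,5) m(1) _ m(2)] elim by (intro of_nat_mono) simp
    then have "f N \<le> real (m ^ r * L n k r \<F> + m * N ^ (r - 1)) / real N ^ r"
      unfolding f_def by (intro divide_right_mono) auto
    also have "\<dots> = (n * (real m / real N)) ^ r * f n + real m / real N"
    proof -
      have "real N ^ r = real N * real N ^ (r - 1)"
        using assms(1) by (simp add: power_eq_if)
      then have "real m * real N ^ (r - 1) / real N ^ r = real m / real N"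
        using N0 by simp
      then show ?thesis
        using n0 by (simp add: f_def add_divide_distrib power_mult_distrib power_divide)
    qed
    also have "\<dots> \<le> (n * u N) ^ r * f n + u N"
      using mu f0 by (intro add_mono mult_right_mono power_mono mult_left_mono) auto
    finally show ?case using elim by (simp add: f_def)
  qed
qed simp

end
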